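(* Let $k\geq 1$ be an integer, let $n$ be an integer with $n\geq k^{3}/2+k^{2}/2+k+5$, and let $G$ be a graph of order $n$ with minimum degree $\delta(G)\geq k$. (i) If $G$ is a subgraph of $N_{k}(n)$, then $\lambda(G)<n-k-2$, unless $G=N_{k}(n)$. (ii) If $G$ is a subgraph of $K_{n-k-1}+K_{k+1}$, then $\lambda(G)<n-k-2$, unless $G=K_{n-k-1}+K_{k+1}$.
   Context: Graphs are finite, simple and undirected. $\lambda(G)$ denotes the spectral radius (largest eigenvalue) of the adjacency matrix of $G$, and $\delta(G)$ its minimum degree. $K_s$ and $\overline{K}_s$ denote the complete graph and the edgeless graph of order $s$; $G\vee H$ denotes the join and $G+H$ the disjoint union of graphs $G$ and $H$. For $k\geq 1$ and $n\geq 2k+1$, \[ N_k(n):=K_k\vee (K_{n-2k-1}+\overline{K}_{k+1}), \] which is a graph of order $n$. *)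

theory Defs
  imports
    "Graph_Theory.Digraph_Component"
    "Graph_Theory.Digraph_Isomorphism"
    "Graph_Theory.Pair_Digraph"
    "Jordan_Normal_Form.Spectral_Radius"
begin

text \<open>
  A finite simple undirected graph is a \<open>pair_graph\<close>: a finite, loop-free digraph whose arc set is
  a symmetric relation, so the edge \<open>uv\<close> is the pair of arcs \<open>(u,v)\<close>, \<open>(v,u)\<close>.
\<close>

definition complete_graph :: "nat \<Rightarrow> nat pair_pre_digraph" where
  "complete_graph s = \<lparr> pverts = {..<s}, parcs = {(u, v). u < s \<and> v < s \<and> u \<noteq> v} \<rparr>"

definition edgeless_graph :: "nat \<Rightarrow> nat pair_pre_digraph" where
  "edgeless_graph s = \<lparr> pverts = {..<s}, parcs = {} \<rparr>"

definition disjoint_union ::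
    "'a pair_pre_digraph \<Rightarrow> 'b pair_pre_digraph \<Rightarrow> ('a + 'b) pair_pre_digraph" where
  "disjoint_union G H = \<lparr>
     pverts = pverts G <+> pverts H,
     parcs = map_prod Inl Inl ` parcs G \<union> map_prod Inr Inr ` parcs H \<rparr>"

definition graph_join ::
    "'a pair_pre_digraph \<Rightarrow> 'b pair_pre_digraph \<Rightarrow> ('a + 'b) pair_pre_digraph" where
  "graph_join G H = \<lparr>
     pverts = pverts G <+> pverts H,
     parcs = parcs (disjoint_union G H)
       \<union> (Inl ` pverts G) \<times> (Inr ` pverts H) \<union> (Inr ` pverts H) \<times> (Inl ` pverts G) \<rparr>"

text \<open>Only meaningful for \<open>n \<ge> 2 * k + 1\<close>, because of the truncated subtraction.\<close>

definition N_graph :: "nat \<Rightarrow> nat \<Rightarrow> (nat + nat + nat) pair_pre_digraph" where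
  "N_graph k n = graph_join (complete_graph k)
     (disjoint_union (complete_graph (n - 2 * k - 1)) (edgeless_graph (k + 1)))"

text \<open>
  Graphs are identified when they are isomorphic, so being a subgraph of \<open>H\<close> means being
  isomorphic to a subgraph of \<open>H\<close> in the labelled sense.
\<close>

definition iso_graph :: "'a pair_pre_digraph \<Rightarrow> 'b pair_pre_digraph \<Rightarrow> bool" where
  "iso_graph G H \<longleftrightarrow> digraph_iso (with_proj G) (with_proj H)"

definition iso_subgraph :: "'a pair_pre_digraph \<Rightarrow> 'b pair_pre_digraph \<Rightarrow> bool" where
  "iso_subgraph G H \<longleftrightarrow> (\<exists>H'. iso_graph G H' \<and> subgraph (with_proj H') (with_proj H))"

definition min_degree :: "'a pair_pre_digraph \<Rightarrow> nat" where
  "min_degree G = Min (out_degree (with_proj G) ` pverts G)"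

definition adjacency_matrix :: "'a pair_pre_digraph \<Rightarrow> 'a list \<Rightarrow> complex mat" where
  "adjacency_matrix G xs =
     mat (length xs) (length xs) (\<lambda>(i, j). if (xs ! i, xs ! j) \<in> parcs G then 1 else 0)"

text \<open>
  The rows and columns of the adjacency matrix follow an arbitrary enumeration of the vertices; the
  lemma \<open>graph_spectral_radius_eq\<close> below shows that the choice does not matter.
\<close>

definition graph_spectral_radius :: "'a pair_pre_digraph \<Rightarrow> real" where
  "graph_spectral_radius G =
     spectral_radius (adjacency_matrix G (SOME xs. distinct xs \<and> set xs = pverts G))"

lemma eigenvalue_adjacency_matrix_iff:
  assumes "distinct xs" "set xs = pverts G"
  shows "eigenvalue (adjacency_matrix G xs) c \<longleftrightarrow>
    (\<exists>f. (\<exists>v\<in>pverts G. f v \<noteq> 0) \<and>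
         (\<forall>v\<in>pverts G. (\<Sum>w\<in>{w \<in> pverts G. (v, w) \<in> parcs G}. f w) = c * f v))"
    (is "?L \<longleftrightarrow> ?R")
proof -
  let ?n = "length xs" and ?A = "adjacency_matrix G xs"
  have bij: "bij_betw ((!) xs) {0..<?n} (pverts G)"
    using assms by (simp add: bij_betw_nth atLeast0LessThan)
  have row: "(?A *\<^sub>v vec ?n (\<lambda>i. f (xs ! i))) $ i =
      (\<Sum>w\<in>{w \<in> pverts G. (xs ! i, w) \<in> parcs G}. f w)" if i: "i < ?n" for f i
  proof -
    have "(?A *\<^sub>v vec ?n (\<lambda>i. f (xs ! i))) $ i =
        (\<Sum>j\<in>{0..<?n}. (\<lambda>w. if (xs ! i, w) \<in> parcs G then f w else 0) (xs ! j))"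
      using i by (auto simp: adjacency_matrix_def scalar_prod_def intro!: sum.cong)
    also have "\<dots> = (\<Sum>w\<in>pverts G. if (xs ! i, w) \<in> parcs G then f w else 0)"
      by (rule sum.reindex_bij_betw[OF bij])
    also have "\<dots> = (\<Sum>w\<in>{w \<in> pverts G. (xs ! i, w) \<in> parcs G}. f w)"
      by (rule sum.inter_filter[symmetric]) (metis assms(2) List.finite_set)
    finally show ?thesis .
  qed
  have "eigenvector ?A (vec ?n (\<lambda>i. f (xs ! i))) c \<longleftrightarrow>
      (\<exists>v\<in>pverts G. f v \<noteq> 0) \<and>
      (\<forall>v\<in>pverts G. (\<Sum>w\<in>{w \<in> pverts G. (v, w) \<in> parcs G}. f w) = c * f v)" for f
  proof -
    have all: "(\<forall>v\<in>pverts G. P v) \<longleftrightarrow> (\<forall>i<?n. P (xs ! i))" for P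
      by (metis assms(2) in_set_conv_nth)
    have dims: "dim_row ?A = ?n" by (simp add: adjacency_matrix_def)
    have "vec ?n (\<lambda>i. f (xs ! i)) = 0\<^sub>v ?n \<longleftrightarrow> (\<forall>v\<in>pverts G. f v = 0)"
      by (auto simp: vec_eq_iff all)
    moreover have "?A *\<^sub>v vec ?n (\<lambda>i. f (xs ! i)) = c \<cdot>\<^sub>v vec ?n (\<lambda>i. f (xs ! i)) \<longleftrightarrow>
        (\<forall>v\<in>pverts G. (\<Sum>w\<in>{w \<in> pverts G. (v, w) \<in> parcs G}. f w) = c * f v)"
      unfolding all vec_eq_iff[of "?A *\<^sub>v _"] using row dims
      by (simp del: index_mult_mat_vec)
    ultimately show ?thesis
      unfolding eigenvector_def dims by auto
  qed
  note ev = this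
  show ?thesis
  proof
    assume ?L
    then obtain x where x: "eigenvector ?A x c" by (auto simp: eigenvalue_def)
    then have "dim_vec x = ?n" by (auto simp: eigenvector_def adjacency_matrix_def)
    define f where "f v = x $ the_inv_into {0..<?n} ((!) xs) v" for v
    have "vec ?n (\<lambda>i. f (xs ! i)) = x"
      using bij \<open>dim_vec x = ?n\<close> by (auto simp: f_def the_inv_into_f_f bij_betw_def)
    with x have "eigenvector ?A (vec ?n (\<lambda>i. f (xs ! i))) c" by simp
    then show ?R unfolding ev by blast
  next
    assume ?R
    then show ?L unfolding ev[symmetric] eigenvalue_def by blast
  qed
qed

lemma graph_spectral_radius_eq:
  assumes "distinct xs" "set xs = pverts G"
  shows "graph_spectral_radius G = spectral_radius (adjacency_matrix G xs)"
proof -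
  define ys where "ys = (SOME xs. distinct xs \<and> set xs = pverts G)"
  have ys: "distinct ys" "set ys = pverts G"
    unfolding ys_def using someI[of "\<lambda>xs. distinct xs \<and> set xs = pverts G" xs] assms by auto
  have "spectrum (adjacency_matrix G ys) = spectrum (adjacency_matrix G xs)"
    unfolding spectrum_def
      eigenvalue_adjacency_matrix_iff[OF ys] eigenvalue_adjacency_matrix_iff[OF assms] ..
  then show ?thesis
    by (simp add: graph_spectral_radius_def spectral_radius_def ys_def)
qed

end

theory Submission
  imports Defs
begin

text \<open>
  A positive vector \<open>x\<close> with \<open>A x < c x\<close> in every coordinate forces the spectral radius of the
  nonnegative matrix \<open>A\<close> below \<open>c\<close>, and this criterion is monotone under deleting edges. Put
  \<open>c = n - k - 2\<close>. In both cases the host graph contains a clique \<open>K\<close> on \<open>c + 1\<close> vertices, and the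
  minimum degree condition forces every missing edge into \<open>K\<close>, so it suffices to give such an \<open>x\<close>
  for the host graph minus one edge \<open>uv\<close> of \<open>K\<close>. Lowering the constant vector on \<open>K\<close> by
  \<open>1 / (c + 2)\<close> at \<open>u\<close> and \<open>v\<close> gains \<open>2 / (c + 2)\<close> in every row of \<open>K\<close>. For \<open>N\<^sub>k(n)\<close> this gain
  pays for raising the \<open>k\<close> dominating vertices by \<open>\<alpha> = 2 / (k (c + 3))\<close>, which in turn
  compensates for their \<open>k + 1\<close> neighbours outside \<open>K\<close>; the latter can be given the weight that
  they need because \<open>c\<close> exceeds \<open>k\<^sup>2 (k + 1) / 2\<close> by at least \<open>3\<close>.
\<close>

section \<open>Bounding the spectral radius by a positive test vector\<close>

text \<open>Take an eigenvector \<open>f\<close> of an eigenvalue of maximal modulus and a vertex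
  \<open>v\<close> maximising \<open>norm (f v) / x (\<phi> v)\<close>, and compare the eigenvalue
  equation at \<open>v\<close> with the row condition there. The test vector lives on the host, and
  \<open>R\<close> need only contain the image of the arcs, which gives the monotonicity under
  deleting edges.\<close>

lemma graph_spectral_radius_less:
  fixes \<phi> :: "'a \<Rightarrow> 'b" and x :: "'b \<Rightarrow> real"
  assumes fin: "finite (pverts G)" and ne: "pverts G \<noteq> {}"
    and bij: "bij_betw \<phi> (pverts G) V"
    and arcs: "\<And>a b. (a, b) \<in> parcs G \<Longrightarrow> (\<phi> a, \<phi> b) \<in> R"
    and R: "R \<subseteq> V \<times> V"
    and pos: "\<And>p. p \<in> V \<Longrightarrow> x p > 0"
    and row: "\<And>p. p \<in> V \<Longrightarrow> sum x (R `` {p}) < c * x p"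
  shows "graph_spectral_radius G < c"
proof -
  obtain xs where xs: "distinct xs" "set xs = pverts G"
    using finite_distinct_list[OF fin] by blast
  let ?A = "adjacency_matrix G xs"
  have A: "?A \<in> carrier_mat (length xs) (length xs)" by (simp add: adjacency_matrix_def)
  have "length xs > 0" using xs ne by auto
  from spectral_radius_mem_max(1)[OF A this] obtain \<mu> where
    mu: "eigenvalue ?A \<mu>" and sr: "spectral_radius ?A = norm \<mu>"
    by (auto simp: spectrum_def)
  from mu obtain f where nz: "\<exists>v\<in>pverts G. f v \<noteq> 0"
    and eig: "\<And>v. v \<in> pverts G \<Longrightarrow> (\<Sum>w\<in>{w \<in> pverts G. (v, w) \<in> parcs G}. f w) = \<mu> * f v"
    unfolding eigenvalue_adjacency_matrix_iff[OF xs] by blast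
  have V: "\<phi> v \<in> V" if "v \<in> pverts G" for v using bij that by (auto simp: bij_betw_def)
  have finV: "finite V" using bij fin by (simp add: bij_betw_finite)
  define r where "r v = norm (f v) / x (\<phi> v)" for v
  obtain v where v: "v \<in> pverts G" and vmax: "\<And>w. w \<in> pverts G \<Longrightarrow> r w \<le> r v"
  proof -
    have "finite (r ` pverts G)" "r ` pverts G \<noteq> {}" using fin ne by auto
    from Max_in[OF this] Max_ge[OF this(1)] that show ?thesis by (metis imageE image_eqI)
  qed
  have rv: "r v > 0"
  proof -
    obtain w where w: "w \<in> pverts G" "f w \<noteq> 0" using nz by blast
    then have "r w > 0" using pos[OF V] by (simp add: r_def)
    then show ?thesis using vmax[OF w(1)] by linarith
  qed
  have f: "norm (f w) = r w * x (\<phi> w)" if "w \<in> pverts G" for w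
    using pos[OF V[OF that]] by (simp add: r_def)
  let ?N = "{w \<in> pverts G. (v, w) \<in> parcs G}"
  have "norm \<mu> * (r v * x (\<phi> v)) = norm (\<Sum>w\<in>?N. f w)"
    using eig[OF v] f[OF v] by (simp add: norm_mult)
  also have "\<dots> \<le> (\<Sum>w\<in>?N. norm (f w))" by (rule norm_sum)
  also have "\<dots> \<le> (\<Sum>w\<in>?N. r v * x (\<phi> w))"
    using f vmax pos[OF V] by (intro sum_mono) (auto intro!: mult_right_mono less_imp_le)
  also have "\<dots> = r v * sum x (\<phi> ` ?N)"
    using bij by (subst sum.reindex) (auto simp: sum_distrib_left bij_betw_def intro: inj_on_subset)
  \<comment> \<open>Arcs of \<open>R\<close> that do not come from \<open>G\<close> only add
    positive terms.\<close>
  also have "\<dots> \<le> r v * sum x (R `` {\<phi> v})"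
    using rv arcs R pos finV
    by (intro mult_left_mono sum_mono2) (auto intro: finite_subset[of _ V] intro!: less_imp_le[OF pos])
  also have "\<dots> < r v * (c * x (\<phi> v))"
    using rv row[OF V[OF v]] by simp
  finally have "norm \<mu> < c" using rv pos[OF V[OF v]] by simp
  then show ?thesis using sr graph_spectral_radius_eq[OF xs] by simp
qed

section \<open>Isomorphic copies, missing edges and degrees\<close>

text \<open>A library isomorphism carries a separate map on arcs; as tails and heads are
  \<open>fst\<close> and \<open>snd\<close> here, that map must be
  \<open>map_prod \<phi> \<phi>\<close> on the arcs of \<open>G\<close>.\<close>

lemma iso_graph_iff:
  "iso_graph G H \<longleftrightarrow> pair_wf_digraph G \<and>
    (\<exists>\<phi>. inj_on \<phi> (pverts G) \<and> pverts H = \<phi> ` pverts G \<and> parcs H = map_prod \<phi> \<phi> ` parcs G)"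
    (is "?L \<longleftrightarrow> ?R")
proof
  assume ?L
  then obtain h where h: "pre_digraph.digraph_isomorphism (with_proj G) h"
    and H: "with_proj H = app_iso h (with_proj G)"
    by (auto simp: iso_graph_def digraph_iso_def)
  have "iso_tail h = fst" "iso_head h = snd"
    using arg_cong[OF H, of tail] arg_cong[OF H, of head] by simp_all
  with h have "iso_arcs h a = map_prod (iso_verts h) (iso_verts h) a" if "a \<in> parcs G" for a
    using that by (simp add: pre_digraph.digraph_isomorphism_def prod_eq_iff)
  moreover have "pverts H = iso_verts h ` pverts G" "parcs H = iso_arcs h ` parcs G"
    using arg_cong[OF H, of verts] arg_cong[OF H, of arcs] by simp_all
  ultimately show ?R
    using h by (auto simp: pre_digraph.digraph_isomorphism_def wf_digraph_wp_iff intro!: exI[of _ "iso_verts h"])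
next
  assume ?R
  then obtain \<phi> where wf: "pair_wf_digraph G" and inj: "inj_on \<phi> (pverts G)"
    and H: "pverts H = \<phi> ` pverts G" "parcs H = map_prod \<phi> \<phi> ` parcs G" by blast
  let ?h = "\<lparr> iso_verts = \<phi>, iso_arcs = map_prod \<phi> \<phi>, iso_head = snd, iso_tail = fst \<rparr>"
  have "parcs G \<subseteq> pverts G \<times> pverts G"
    using pair_wf_digraph.wellformed'[OF wf] by auto
  moreover have "inj_on (map_prod \<phi> \<phi>) (pverts G \<times> pverts G)"
    using inj by (simp add: inj_on_def)
  ultimately have "inj_on (map_prod \<phi> \<phi>) (parcs G)"
    by (rule inj_on_subset[rotated])
  then have "pre_digraph.digraph_isomorphism (with_proj G) ?h"
    using wf inj by (auto simp: pre_digraph.digraph_isomorphism_def wf_digraph_wp_iff)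
  moreover have "with_proj H = app_iso ?h (with_proj G)"
    by (simp add: with_proj_def app_iso_def H)
  ultimately show ?L unfolding iso_graph_def digraph_iso_def by blast
qed

text \<open>Equal orders make the copy of \<open>G\<close> spanning, so a copy that is not all of
  \<open>H\<close> misses an arc and, by symmetry, its reverse.\<close>

lemma iso_subgraph_missing_edge:
  assumes G: "pair_graph G" and sub: "iso_subgraph G H" and niso: "\<not> iso_graph G H"
    and card: "card (pverts G) = card (pverts H)" and fin: "finite (pverts H)"
  obtains \<phi> u v where "bij_betw \<phi> (pverts G) (pverts H)" "(u, v) \<in> parcs H"
    "\<And>a b. (a, b) \<in> parcs G \<Longrightarrow> (\<phi> a, \<phi> b) \<in> parcs H - {(u, v), (v, u)}"
proof -
  obtain H' where iso: "iso_graph G H'" and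
    H': "pverts H' \<subseteq> pverts H" "parcs H' \<subseteq> parcs H"
    using sub by (auto simp: iso_subgraph_def subgraph_def)
  then obtain \<phi> where \<phi>: "inj_on \<phi> (pverts G)" "pverts H' = \<phi> ` pverts G"
      "parcs H' = map_prod \<phi> \<phi> ` parcs G"
    unfolding iso_graph_iff by blast
  have V: "pverts H' = pverts H"
    using H'(1) card \<phi> fin by (metis card_image card_subset_eq)
  then have "parcs H' \<noteq> parcs H"
    using iso niso by (auto simp: iso_graph_iff)
  then obtain u v where uv: "(u, v) \<in> parcs H" "(u, v) \<notin> parcs H'" using H'(2) by auto
  moreover have "sym (parcs G)"
    using pair_sym_digraph.pair_sym_arcs G
    by (metis pair_bidirected_digraph.axioms(1) pair_graph.axioms(2) pair_pseudo_graph.axioms(2)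
          symmetric_def with_proj_simps(3))
  then have "(v, u) \<notin> parcs H'" using uv \<phi>(3) by (auto dest: symD)
  moreover have "(\<phi> a, \<phi> b) \<in> parcs H'" if "(a, b) \<in> parcs G" for a b
    using that \<phi>(3) by force
  moreover have "bij_betw \<phi> (pverts G) (pverts H)"
    using \<phi> V by (simp add: bij_betw_def)
  ultimately show ?thesis
    using that[of \<phi> u v] H'(2) by blast
qed

lemma min_degree_le:
  assumes "pair_graph G" "a \<in> pverts G"
  shows "min_degree G \<le> card (parcs G `` {a})"
proof -
  interpret pair_graph G by fact
  have "out_degree (with_proj G) a = card (Pair a ` (parcs G `` {a}))"
    unfolding out_degree_def out_arcs_def by (rule arg_cong[where f = card]) auto
  also have "\<dots> = card (parcs G `` {a})" by (rule card_image) (simp add: inj_on_def)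
  finally show ?thesis
    using assms(2) pair_finite_verts unfolding min_degree_def by (metis Min_le finite_imageI image_eqI)
qed

section \<open>Test vectors for a host graph minus one edge of its clique\<close>

text \<open>\<open>N\<close> plays the neighbours of \<open>p\<close> within \<open>K\<close> once
  \<open>uv\<close> is removed. Away from \<open>u\<close> and \<open>v\<close>, dropping
  \<open>x p\<close> from \<open>sum x K\<close> suffices. At \<open>u\<close>, both
  \<open>x u\<close> and \<open>x v\<close> drop out, and the claim reduces to
  \<open>(c + 2) * \<delta> \<le> g v\<close>; likewise at \<open>v\<close>.\<close>

lemma clique_minus_edge_row:
  fixes x g :: "'a \<Rightarrow> real"
  assumes fin: "finite K" and uv: "u \<in> K" "v \<in> K" "u \<noteq> v" and p: "p \<in> K"
    and x: "\<And>q. q \<in> K \<Longrightarrow> x q = g q - (if q \<in> {u, v} then \<delta> else 0)"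
    and nonneg: "\<And>q. q \<in> K \<Longrightarrow> x q \<ge> 0"
    and \<delta>: "(c + 2) * \<delta> \<le> g u" "(c + 2) * \<delta> \<le> g v"
    and N: "N \<subseteq> K - {p}" "p = u \<Longrightarrow> v \<notin> N" "p = v \<Longrightarrow> u \<notin> N"
  shows "sum x N \<le> c * x p + (sum x K - (c + 1) * g p)"
proof (cases "p \<in> {u, v}")
  case True
  have "sum x N \<le> sum x (K - {u, v})"
    using fin N True nonneg by (intro sum_mono2) auto
  also have "\<dots> = sum x K - (x u + x v)"
    using fin uv by (subst sum_diff) auto
  finally have "sum x N \<le> sum x K - (g u + g v - 2 * \<delta>)" using x[OF uv(1)] x[OF uv(2)] by simp
  moreover have "c * x p = c * g p - c * \<delta>" using True x[OF p] by (simp add: right_diff_distrib)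
  ultimately show ?thesis using True \<delta> by (auto simp: algebra_simps)
next
  case False
  have "sum x N \<le> sum x (K - {p})"
    using fin N nonneg by (intro sum_mono2) auto
  also have "\<dots> = sum x K - x p" using fin p by (subst sum_diff) auto
  finally show ?thesis using False x[OF p] by (simp add: algebra_simps)
qed

lemma sum_minus_two_points:
  fixes g :: "'a \<Rightarrow> real"
  assumes "finite K" "u \<in> K" "v \<in> K" "u \<noteq> v"
  shows "(\<Sum>q\<in>K. g q - (if q \<in> {u, v} then \<delta> else 0)) = sum g K - 2 * \<delta>"
proof -
  have "(\<Sum>q\<in>K. if q \<in> {u, v} then \<delta> else 0) = (\<Sum>q\<in>{u, v}. \<delta>)"
    using assms by (intro sum.mono_neutral_cong_right) auto
  then show ?thesis using assms by (simp add: sum_subtractf)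
qed

text \<open>Lowering the weight 1 at \<open>u\<close> and \<open>v\<close> gives every row of
  \<open>K\<close> a slack of \<open>2 * \<delta>\<close>; a row of \<open>I\<close> is already
  strict, having at most \<open>card I - 1\<close> neighbours of weight 1.\<close>

lemma test_vector_disjoint_cliques:
  fixes c :: real
  assumes fin: "finite K" "finite I" "K \<inter> I = {}" and uv: "u \<in> K" "v \<in> K" "u \<noteq> v"
    and c: "c > 0" "card K = c + 1" "card I < c + 1"
    and RK: "\<And>p. p \<in> K \<Longrightarrow> R `` {p} \<subseteq> K - {p}"
    and RI: "\<And>p. p \<in> I \<Longrightarrow> R `` {p} \<subseteq> I - {p}"
    and R: "(u, v) \<notin> R" "(v, u) \<notin> R"
  obtains x :: "'a \<Rightarrow> real" where "\<And>p. x p > 0"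
    "\<And>p. p \<in> K \<union> I \<Longrightarrow> sum x (R `` {p}) < c * x p"
proof -
  \<comment> \<open>The largest value that \<open>clique_minus_edge_row\<close> admits for base
    weight 1.\<close>
  define \<delta> where "\<delta> = 1 / (c + 2)"
  define x where "x q = 1 - (if q \<in> {u, v} then \<delta> else 0)" for q
  have \<delta>: "0 < \<delta>" "\<delta> < 1" "(c + 2) * \<delta> = 1" using c by (auto simp: \<delta>_def)
  have pos: "x p > 0" for p using \<delta> by (simp add: x_def)
  have S: "sum x K = c + 1 - 2 * \<delta>"
    unfolding x_def using sum_minus_two_points[of K u v "\<lambda>_. 1" \<delta>] fin uv c by simp
  have "sum x (R `` {p}) < c * x p" if "p \<in> K \<union> I" for p
  proof (cases "p \<in> K")
    case True
    have "sum x (R `` {p}) \<le> c * x p + (sum x K - (c + 1) * 1)"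
      using clique_minus_edge_row[of K u v p x "\<lambda>_. 1" \<delta> c "R `` {p}"] fin uv True pos \<delta> RK[OF True] R
      by (auto simp: x_def less_imp_le)
    then show ?thesis using S \<delta> by simp
  next
    case False
    then have p: "p \<in> I" using that by simp
    have "sum x (R `` {p}) \<le> sum x (I - {p})"
      using RI[OF p] fin pos by (intro sum_mono2) (auto simp: less_imp_le)
    also have "\<dots> = (\<Sum>q\<in>I - {p}. 1)" using fin uv by (intro sum.cong) (auto simp: x_def)
    also have "\<dots> = card I - 1" using p fin by (simp add: card_Diff_singleton)
    also have "\<dots> < c" using c p fin by (cases "card I") auto
    also have "c = c * x p" using False uv by (auto simp: x_def)
    finally show ?thesis .
  qed
  with pos that show ?thesis by blast
qed

text \<open>\<open>A\<close> plays the dominating vertices of \<open>N_graph\<close>,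
  \<open>K\<close> these together with the complete part, \<open>I\<close> the independent part.
  Rows in \<open>A\<close> and in \<open>K - A\<close> both reduce to
  \<open>sum x K < c + 1\<close>; rows in \<open>I\<close> reduce to
  \<open>k * (1 + \<alpha>) < c * y\<close>, which is where the full lower bound on \<open>c\<close>
  enters.\<close>

lemma test_vector_clique_with_pendants:
  fixes c :: real
  assumes fin: "finite K" "finite I" "K \<inter> I = {}" and A: "A \<subseteq> K"
    and uv: "u \<in> K" "v \<in> K" "u \<noteq> v"
    and k: "k \<ge> 1" "card A = k" "card I = k + 1"
    and c: "card K = c + 1" "c \<ge> real k ^ 3 / 2 + real k ^ 2 / 2 + 3"
    and RA: "\<And>p. p \<in> A \<Longrightarrow> R `` {p} \<subseteq> (K - {p}) \<union> I"
    and RB: "\<And>p. p \<in> K - A \<Longrightarrow> R `` {p} \<subseteq> K - {p}"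
    and RI: "\<And>p. p \<in> I \<Longrightarrow> R `` {p} \<subseteq> A"
    and R: "(u, v) \<notin> R" "(v, u) \<notin> R"
  obtains x :: "'a \<Rightarrow> real" where "\<And>p. x p > 0"
    "\<And>p. p \<in> K \<union> I \<Longrightarrow> sum x (R `` {p}) < c * x p"
proof -
  define \<delta> where "\<delta> = 1 / (c + 2)"
  \<comment> \<open>Raising \<open>A\<close> costs \<open>k * \<alpha> = 2 / (c + 3)\<close> in
    total, just below the gain \<open>2 * \<delta> = 2 / (c + 2)\<close>.\<close>
  define \<alpha> where "\<alpha> = 2 / (k * (c + 3))"
  \<comment> \<open>Raising a vertex of \<open>A\<close> by \<open>\<alpha>\<close> frees
    \<open>\<alpha> * (c + 1)\<close> in the clique estimate of its row; \<open>y\<close> spends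
    exactly this on the \<open>k + 1\<close> vertices of \<open>I\<close>.\<close>
  define y where "y = \<alpha> * (c + 1) / (k + 1)"
  define g where "g q = (if q \<in> A then 1 + \<alpha> else 1)" for q
  define x where "x q = (if q \<in> I then y else g q - (if q \<in> {u, v} then \<delta> else 0))" for q
  have c0: "c \<ge> 3" using c(2) by (smt (verit) divide_nonneg_nonneg of_nat_0_le_iff zero_le_power)
  have \<delta>: "0 < \<delta>" "\<delta> < 1" "(c + 2) * \<delta> = 1" using c0 by (auto simp: \<delta>_def)
  have \<alpha>: "\<alpha> > 0" using c0 k by (simp add: \<alpha>_def)
  have ka: "k * \<alpha> = 2 / (c + 3)" using k by (simp add: \<alpha>_def)
  have y: "y > 0" "(k + 1) * y = \<alpha> * (c + 1)" using \<alpha> c0 by (auto simp: y_def simp del: of_nat_Suc)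
  \<comment> \<open>With \<open>y\<close> and \<open>\<alpha>\<close> inserted and denominators
    cleared, this reads
    \<open>k^2 * (k + 1) * (c + 3) < 2 * (c * (c + 1) - k * (k + 1))\<close>.\<close>
  have cy: "k * (1 + \<alpha>) < c * y"
  proof -
    have T: "real k ^ 2 * (k + 1) \<le> 2 * (c - 3)"
      using c(2) by (simp add: power2_eq_square power3_eq_cube algebra_simps)
    \<comment> \<open>By \<open>T\<close> the left side is at most \<open>2 * (c^2 - 9)\<close>, so
      this comparison is all that is left. For \<open>k \<ge> 2\<close> it follows from
      \<open>T\<close> again.\<close>
    have kk: "real k * (k + 1) < c + 9"
    proof (cases "k = 1")
      case False
      then have "2 * (real k * (k + 1)) \<le> real k * (real k * (k + 1))"
        using k by (intro mult_right_mono) auto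
      then show ?thesis using T by (simp add: power2_eq_square algebra_simps)
    qed (use c0 in auto)
    have "real k ^ 2 * (k + 1) * (c + 3) \<le> 2 * (c - 3) * (c + 3)"
      using T c0 by (intro mult_right_mono) auto
    also have "\<dots> < 2 * (c * (c + 1) - real k * (k + 1))"
      using kk by (simp add: algebra_simps)
    finally have "real k * (k + 1) * (k * (c + 3)) < 2 * (c * (c + 1) - real k * (k + 1))"
      by (simp add: power2_eq_square mult_ac)
    then have "real k * (k + 1) < \<alpha> * (c * (c + 1) - real k * (k + 1))"
      using k c0 by (simp add: \<alpha>_def pos_less_divide_eq)
    then have "k * (1 + \<alpha>) * (k + 1) < c * (\<alpha> * (c + 1))" by (simp add: algebra_simps)
    also have "\<dots> = c * y * (k + 1)" unfolding y(2)[symmetric] by (simp add: mult_ac)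
    finally show ?thesis using k by (smt (verit) mult_right_mono of_nat_0_le_iff)
  qed
  have g1: "g q \<ge> 1" for q using \<alpha> by (simp add: g_def)
  have pos: "x p > 0" for p using \<delta> y g1[of p] by (simp add: x_def)
  have xK: "x q = g q - (if q \<in> {u, v} then \<delta> else 0)" if "q \<in> K" for q
    using that fin by (auto simp: x_def)
  have "sum g K = (\<Sum>q\<in>K. 1 + (if q \<in> A then \<alpha> else 0))" by (intro sum.cong) (auto simp: g_def)
  also have "\<dots> = c + 1 + k * \<alpha>"
    using fin A c k by (simp add: sum.distrib sum.If_cases Int_absorb1 Int_absorb2)
  finally have "sum x K = c + 1 + k * \<alpha> - 2 * \<delta>"
    using sum_minus_two_points[of K u v g \<delta>] fin uv xK by (simp cong: sum.cong)
  also have "\<dots> < c + 1" using frac_less2[of 2 2 "c + 2" "c + 3"] c0 by (simp add: ka \<delta>_def)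
  finally have S: "sum x K < c + 1" .
  \<comment> \<open>Intersecting with \<open>K\<close> sets aside the neighbours in
    \<open>I\<close>, which only vertices of \<open>A\<close> can have.\<close>
  have clique: "sum x (R `` {p} \<inter> K) \<le> c * x p + (sum x K - (c + 1) * g p)" if p: "p \<in> K" for p
  proof (rule clique_minus_edge_row[of K u v p x g \<delta>])
    show "R `` {p} \<inter> K \<subseteq> K - {p}" using RA[of p] RB[of p] p fin by (cases "p \<in> A") auto
    show "x q \<ge> 0" for q using pos[of q] by simp
  qed (use fin uv p xK \<delta> g1 R in auto)
  have "sum x (R `` {p}) < c * x p" if KI: "p \<in> K \<union> I" for p
  proof -
    consider "p \<in> A" | "p \<in> K - A" | "p \<in> I" using KI by blast
    then show ?thesis
    proof cases
      case 1
      have "sum x (R `` {p}) \<le> sum x (R `` {p} \<inter> K \<union> I)"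
        using RA[OF 1] fin pos by (intro sum_mono2) (auto simp: less_imp_le)
      also have "\<dots> = sum x (R `` {p} \<inter> K) + sum x I"
        using fin by (intro sum.union_disjoint) auto
      also have "sum x I = (k + 1) * y" using k by (simp add: x_def)
      also have "sum x (R `` {p} \<inter> K) + (k + 1) * y < c * x p"
        using clique[of p] 1 A y(2) S by (auto simp: g_def algebra_simps)
      finally show ?thesis .
    next
      case 2
      then have "sum x (R `` {p}) = sum x (R `` {p} \<inter> K)"
        using RB[OF 2] by (intro arg_cong[where f = "sum x"]) auto
      then show ?thesis using clique[of p] 2 S by (auto simp: g_def)
    next
      case 3
      have "sum x (R `` {p}) \<le> sum x A"
        using RI[OF 3] fin A pos by (intro sum_mono2) (auto simp: less_imp_le intro: finite_subset)
      also have "\<dots> \<le> (\<Sum>q\<in>A. 1 + \<alpha>)"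
        using A xK \<delta> by (intro sum_mono) (auto simp: g_def)
      also have "\<dots> < c * x p" using 3 k cy by (simp add: x_def)
      finally show ?thesis .
    qed
  qed
  with pos that show ?thesis by blast
qed

section \<open>The two host graphs\<close>

theorem theorem7:
  fixes G :: "'a pair_pre_digraph" and k n :: nat
  assumes "k \<ge> 1"
    and "real n \<ge> real k ^ 3 / 2 + real k ^ 2 / 2 + real k + 5"
    and "pair_graph G"
    and "card (pverts G) = n"
    and "min_degree G \<ge> k"
  shows "(iso_subgraph G (N_graph k n) \<longrightarrow> \<not> iso_graph G (N_graph k n) \<longrightarrow>
            graph_spectral_radius G < real n - real k - 2) \<and>
         (iso_subgraph G (disjoint_union (complete_graph (n - k - 1)) (complete_graph (k + 1))) \<longrightarrow>
            \<not> iso_graph G (disjoint_union (complete_graph (n - k - 1)) (complete_graph (k + 1))) \<longrightarrow>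
            graph_spectral_radius G < real n - real k - 2)"
proof (intro conjI impI)
  \<comment> \<open>\<open>c + 1 = n - k - 1\<close> is the order of the large clique in either
    host.\<close>
  define c where "c = real n - real k - 2"
  have c: "c \<ge> real k ^ 3 / 2 + real k ^ 2 / 2 + 3" using assms(2) by (simp add: c_def)
  have "real k \<le> real k ^ 2" "real k \<le> real k ^ 3" using assms(1) by (simp_all add: self_le_power)
  \<comment> \<open>This makes the truncated subtractions in both hosts genuine, and in the second
    host it makes the small clique smaller than the large one.\<close>
  then have ck: "c > k" "c > 0" using c by linarith+
  then have "real (2 * k + 1) < real n" by (simp add: c_def)
  then have nk: "n > 2 * k + 1" by linarith
  interpret pair_graph G by fact
  have fin: "finite (pverts G)" by (rule pair_finite_verts)
  have ne: "pverts G \<noteq> {}" using assms(4) nk by auto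
  {
    let ?H = "N_graph k n"
    assume sub: "iso_subgraph G ?H" and niso: "\<not> iso_graph G ?H"
    define A where "A = (Inl ` {..<k} :: (nat + nat + nat) set)"
    define B where "B = (Inr ` Inl ` {..<n - 2 * k - 1} :: (nat + nat + nat) set)"
    define I where "I = (Inr ` Inr ` {..<k + 1} :: (nat + nat + nat) set)"
    note defs = N_graph_def graph_join_def disjoint_union_def complete_graph_def edgeless_graph_def
    have V: "pverts ?H = A \<union> B \<union> I"
      by (auto simp: defs A_def B_def I_def)
    have arcs: "parcs ?H = {(p, q). p \<noteq> q \<and>
        (p \<in> A \<and> q \<in> A \<union> B \<union> I \<or> p \<in> B \<and> q \<in> A \<union> B \<or> p \<in> I \<and> q \<in> A)}"
      by (auto simp: defs A_def B_def I_def)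
    have disj: "A \<inter> B = {}" "A \<inter> I = {}" "B \<inter> I = {}" by (auto simp: A_def B_def I_def)
    have finAI: "finite A" "finite B" "finite I" by (simp_all add: A_def B_def I_def)
    have cards: "card A = k" "card B = n - 2 * k - 1" "card I = k + 1"
      by (simp_all add: A_def B_def I_def card_image inj_on_def)
    have cardK: "card (A \<union> B) = c + 1"
      using cards finAI disj nk by (simp add: card_Un_disjoint c_def of_nat_diff)
    have "card (pverts G) = card (pverts ?H)"
      unfolding V using assms(4) cards finAI disj nk by (simp add: card_Un_disjoint Int_Un_distrib2)
    with iso_subgraph_missing_edge[OF assms(3) sub niso] obtain \<phi> u v where
      \<phi>: "bij_betw \<phi> (pverts G) (pverts ?H)" and uv: "(u, v) \<in> parcs ?H"
      and \<phi>arcs: "\<And>a b. (a, b) \<in> parcs G \<Longrightarrow> (\<phi> a, \<phi> b) \<in> parcs ?H - {(u, v), (v, u)}"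
      using V finAI by (metis finite_Un)
    \<comment> \<open>Vertices of \<open>I\<close> have only the \<open>k\<close> vertices of
      \<open>A\<close> as neighbours, so a missing edge there would leave degree at most
      \<open>k - 1\<close>. The set equation covers both orientations of the missing edge.\<close>
    have no_pendant: False if pq: "p \<in> I" "q \<in> A" "{(p, q), (q, p)} = {(u, v), (v, u)}" for p q
    proof -
      have "p \<in> \<phi> ` pverts G" using \<phi> V pq(1) by (simp add: bij_betw_def)
      then obtain a where a: "a \<in> pverts G" "\<phi> a = p" by blast
      have "\<phi> ` (parcs G `` {a}) \<subseteq> A - {q}"
        using \<phi>arcs[of a] a(2) pq disj unfolding arcs by blast
      moreover have "inj_on \<phi> (parcs G `` {a})"
        using \<phi> by (auto simp: bij_betw_def dest: in_arcsD2 intro: inj_on_subset)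
      ultimately have "card (parcs G `` {a}) \<le> card (A - {q})"
        using finAI by (metis card_inj_on_le finite_Diff)
      also have "\<dots> < k" using pq finAI cards assms(1) by (simp add: card_Diff_singleton)
      finally show False using min_degree_le[OF assms(3) a(1)] assms(5) by simp
    qed
    have uvK: "u \<in> A \<union> B" "v \<in> A \<union> B" "u \<noteq> v"
      using uv no_pendant[of u v] no_pendant[of v u] disj by (auto simp: arcs)
    let ?R = "parcs ?H - {(u, v), (v, u)}"
    obtain x :: "_ \<Rightarrow> real" where x: "\<And>p. x p > 0"
      "\<And>p. p \<in> A \<union> B \<union> I \<Longrightarrow> sum x (?R `` {p}) < c * x p"
      by (rule test_vector_clique_with_pendants[of "A \<union> B" I A u v k c ?R])
        (use finAI disj uvK cards cardK c assms(1) in \<open>auto simp: arcs\<close>)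
    show "graph_spectral_radius G < real n - real k - 2"
      unfolding c_def[symmetric]
    proof (rule graph_spectral_radius_less[OF fin ne \<phi> \<phi>arcs])
      show "?R \<subseteq> pverts ?H \<times> pverts ?H" unfolding V arcs by auto
      show "x p > 0" "sum x (?R `` {p}) < c * x p" if "p \<in> pverts ?H" for p
        using x that unfolding V by simp_all
    qed
  next
    define H where "H = disjoint_union (complete_graph (n - k - 1)) (complete_graph (k + 1))"
    assume "iso_subgraph G (disjoint_union (complete_graph (n - k - 1)) (complete_graph (k + 1)))"
      and "\<not> iso_graph G (disjoint_union (complete_graph (n - k - 1)) (complete_graph (k + 1)))"
    then have sub: "iso_subgraph G H" and niso: "\<not> iso_graph G H" by (simp_all add: H_def)
    define K where "K = (Inl ` {..<n - k - 1} :: (nat + nat) set)"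
    define I where "I = (Inr ` {..<k + 1} :: (nat + nat) set)"
    note defs = H_def disjoint_union_def complete_graph_def
    have V: "pverts H = K \<union> I" by (auto simp: defs K_def I_def)
    have arcs: "parcs H = {(p, q). p \<noteq> q \<and> (p \<in> K \<and> q \<in> K \<or> p \<in> I \<and> q \<in> I)}"
      by (auto simp: defs K_def I_def)
    have disj: "K \<inter> I = {}" by (auto simp: K_def I_def)
    have finKI: "finite K" "finite I" by (simp_all add: K_def I_def)
    have cards: "card K = n - k - 1" "card I = k + 1"
      by (simp_all add: K_def I_def card_image inj_on_def)
    have cardK: "card K = c + 1"
      using cards nk by (simp add: c_def of_nat_diff)
    have "card (pverts G) = card (pverts H)"
      unfolding V using assms(4) cards finKI disj nk by (simp add: card_Un_disjoint)
    with iso_subgraph_missing_edge[OF assms(3) sub niso] obtain \<phi> u v where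
      \<phi>: "bij_betw \<phi> (pverts G) (pverts H)" and uv: "(u, v) \<in> parcs H"
      and \<phi>arcs: "\<And>a b. (a, b) \<in> parcs G \<Longrightarrow> (\<phi> a, \<phi> b) \<in> parcs H - {(u, v), (v, u)}"
      using V finKI by (metis finite_Un)
    \<comment> \<open>Inside the clique \<open>I\<close> of order \<open>k + 1\<close> every degree
      is exactly \<open>k\<close>, so no edge can be missing. Both ends lie in \<open>I\<close>, so
      one orientation is enough.\<close>
    have no_small: False if pq: "p \<in> I" "q \<in> I" "p \<noteq> q" "(p, q) = (u, v)" for p q
    proof -
      have "p \<in> \<phi> ` pverts G" using \<phi> V pq(1) by (simp add: bij_betw_def)
      then obtain a where a: "a \<in> pverts G" "\<phi> a = p" by blast
      have "\<phi> ` (parcs G `` {a}) \<subseteq> I - {p} - {q}"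
        using \<phi>arcs[of a] a(2) pq disj unfolding arcs by blast
      moreover have "inj_on \<phi> (parcs G `` {a})"
        using \<phi> by (auto simp: bij_betw_def dest: in_arcsD2 intro: inj_on_subset)
      ultimately have "card (parcs G `` {a}) \<le> card (I - {p} - {q})"
        using finKI by (metis card_inj_on_le finite_Diff)
      also have "\<dots> < k" using pq finKI cards assms(1) by (simp add: card_Diff_singleton)
      finally show False using min_degree_le[OF assms(3) a(1)] assms(5) by simp
    qed
    have uvK: "u \<in> K" "v \<in> K" "u \<noteq> v"
      using uv no_small[of u v] disj by (auto simp: arcs)
    let ?R = "parcs H - {(u, v), (v, u)}"
    obtain x :: "_ \<Rightarrow> real" where x: "\<And>p. x p > 0"
      "\<And>p. p \<in> K \<union> I \<Longrightarrow> sum x (?R `` {p}) < c * x p"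
      by (rule test_vector_disjoint_cliques[of K I u v c ?R])
        (use finKI disj uvK cards cardK ck in \<open>auto simp: arcs\<close>)
    show "graph_spectral_radius G < real n - real k - 2"
      unfolding c_def[symmetric]
    proof (rule graph_spectral_radius_less[OF fin ne \<phi> \<phi>arcs])
      show "?R \<subseteq> pverts H \<times> pverts H" unfolding V arcs by auto
      show "x p > 0" "sum x (?R `` {p}) < c * x p" if "p \<in> pverts H" for p
        using x that unfolding V by simp_all
    qed
  }
qed

end
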